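(* Let $u$, $v$ and $w$ be positive numbers with $u<v<w<1$, and let $r_k$, $k=1, 2, \dots$, be a sequence of positive numbers satisfying $u<r_k<v$. Let $(f_k)_{k\ge1}$ be a sequence in $\mathrm{Aut}(\Delta)$ such that the sets $f_k(\overline{\Delta}_{w})$ are pairwise disjoint. Then the domain $$D = \Delta\setminus\Big(\bigcup_{k=1}^{\infty}f_k(\overline{\Delta}_{r_k})\Big)$$ is a holomorphic homogeneous regular domain.
   Context: $\Delta$ is the open unit disc in $\mathbb{C}$, $\mathrm{Aut}(\Delta)$ its holomorphic automorphism group, $\Delta_{r}$ the open disc with center $0$ and radius $r$, and $\overline{\Delta}_r$ its closure. For a bounded domain $D\subset\mathbb{C}$ and $p\in D$, the squeezing function is $s_D(p)=\sup_f\,\sup\{r:\Delta_r\subset f(D)\}$, where the outer supremum is over all injective holomorphic maps $f:D\to\Delta$ with $f(p)=0$. A holomorphic homogeneous regular domain is a bounded domain whose squeezing function has a positive lower bound. *)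

theory Defs
  imports "HOL-Complex_Analysis.Complex_Analysis"
begin

text \<open>Functions are total, so an automorphism of \<open>S\<close> is a function whose restriction to \<open>S\<close>
  is one; its values outside \<open>S\<close> are arbitrary.\<close>

definition holomorphic_aut :: "complex set \<Rightarrow> (complex \<Rightarrow> complex) set" where
  "holomorphic_aut S = {f. f holomorphic_on S \<and> f ` S \<subseteq> S \<and>
     (\<exists>g. g holomorphic_on S \<and> g ` S \<subseteq> S \<and> (\<forall>z\<in>S. g (f z) = z \<and> f (g z) = z))}"

definition bounded_domain :: "complex set \<Rightarrow> bool" where
  "bounded_domain D \<longleftrightarrow> open D \<and> connected D \<and> D \<noteq> {} \<and> bounded D"

text \<open>For a bounded domain \<open>D\<close> and \<open>p \<in> D\<close> both suprema range over nonempty sets (an affine map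
  is admissible; \<open>f ` D\<close> is open and contains \<open>0\<close>) that are bounded above by \<open>1\<close>, so the
  real-valued \<open>Sup\<close> is the genuine supremum. Outside that situation the value is irrelevant.\<close>

definition squeezing :: "complex set \<Rightarrow> complex \<Rightarrow> real" where
  "squeezing D p =
     (SUP f \<in> {f. f holomorphic_on D \<and> inj_on f D \<and> f ` D \<subseteq> ball 0 1 \<and> f p = 0}.
        Sup {r. 0 < r \<and> ball 0 r \<subseteq> f ` D})"

definition holomorphic_homogeneous_regular :: "complex set \<Rightarrow> bool" where
  "holomorphic_homogeneous_regular D \<longleftrightarrow>
     bounded_domain D \<and> (\<exists>c>0. \<forall>p\<in>D. c \<le> squeezing D p)"

end

theory Submission
  imports Defs
begin

text \<open>Put \<open>m = (v + w) / 2\<close>. If \<open>p\<close> lies in none of the discs \<open>f k ` ball 0 m\<close>, then by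
  Schwarz--Pick its pseudohyperbolic distance to every hole is bounded below, and the Moebius map
  sending \<open>p\<close> to \<open>0\<close> is a good competitor. If \<open>p\<close> lies in \<open>f k ` ball 0 m\<close>, apply the inverse of
  \<open>f k\<close> and then the inversion \<open>z \<mapsto> r k / z\<close>. This embeds \<open>D\<close> in the disc, with image containing
  the annulus \<open>r k / w < norm \<zeta> < 1\<close>, while the image of \<open>p\<close> has norm above \<open>r k / m\<close>; again a
  pseudohyperbolic disc of uniform radius around it lies in the image.\<close>

section \<open>Pseudohyperbolic distance in the unit disc\<close>

text \<open>The denominator \<open>1 - cnj w * z\<close> has norm at most 2. This turns
  pseudohyperbolic closeness into Euclidean closeness.\<close>

lemma norm_diff_le_Moebius:
  assumes "norm w < 1" "norm z < 1"
  shows "norm (z - w) \<le> 2 * norm (Moebius_function 0 w z)"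
proof -
  have wz: "norm (cnj w * z) < 1"
    using assms norm_mult_less[of "cnj w" 1 z 1] by simp
  then have pos: "0 < norm (1 - cnj w * z)"
    by auto
  have "norm (1 - cnj w * z) \<le> norm (1::complex) + norm (cnj w * z)"
    by (rule norm_triangle_ineq4)
  then have "norm (1 - cnj w * z) \<le> 2"
    using wz by simp
  then have "norm (Moebius_function 0 w z) * norm (1 - cnj w * z)
      \<le> norm (Moebius_function 0 w z) * 2"
    by (intro mult_left_mono) auto
  moreover have "norm (Moebius_function 0 w z) * norm (1 - cnj w * z) = norm (z - w)"
    using pos by (simp add: Moebius_function_simple norm_divide)
  ultimately show ?thesis by simp
qed

lemma inj_on_Moebius:
  assumes "norm w < 1"
  shows "inj_on (Moebius_function 0 w) (ball 0 1)"
  by (rule inj_on_inverseI[where g = "Moebius_function 0 (- w)"])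
     (use assms in \<open>auto intro!: Moebius_function_compose\<close>)

text \<open>Moebius maps moving \<open>p\<close> and \<open>g p\<close> to the origin reduce this to
  the Schwarz lemma for \<open>h\<close>.\<close>

lemma Schwarz_Pick:
  assumes holg: "g holomorphic_on ball 0 1" and img: "g ` ball 0 1 \<subseteq> ball 0 1"
    and p: "norm p < 1" and q: "norm q < 1"
  shows "norm (Moebius_function 0 (g p) (g q)) \<le> norm (Moebius_function 0 p q)"
proof -
  define h where "h = Moebius_function 0 (g p) \<circ> g \<circ> Moebius_function 0 (- p)"
  have gp: "norm (g p) < 1"
    using img p by (meson image_subset_iff mem_ball_0)
  have M: "Moebius_function 0 (- p) ` ball 0 1 \<subseteq> ball 0 1"
    using p by (auto simp: Moebius_function_norm_lt_1)
  have "h holomorphic_on ball 0 1"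
    unfolding h_def
  proof (intro holomorphic_on_compose)
    show "Moebius_function 0 (- p) holomorphic_on ball 0 1"
      using p by (simp add: Moebius_function_holomorphic)
    show "g holomorphic_on Moebius_function 0 (- p) ` ball 0 1"
      using holg M holomorphic_on_subset by blast
    show "Moebius_function 0 (g p) holomorphic_on g ` Moebius_function 0 (- p) ` ball 0 1"
      by (rule holomorphic_on_subset[OF Moebius_function_holomorphic[OF gp]]) (use M img in blast)
  qed
  moreover have "h 0 = 0"
    by (simp add: h_def Moebius_function_of_zero Moebius_function_eq_zero)
  moreover have "norm (h z) < 1" if "norm z < 1" for z
  proof -
    have "Moebius_function 0 (- p) z \<in> ball 0 1"
      using M that by (meson image_subset_iff mem_ball_0)
    then have "norm (g (Moebius_function 0 (- p) z)) < 1"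
      using img by (meson image_subset_iff mem_ball_0)
    then show ?thesis
      unfolding h_def using gp by (simp add: Moebius_function_norm_lt_1)
  qed
  moreover have "norm (Moebius_function 0 p q) < 1"
    using p q by (rule Moebius_function_norm_lt_1)
  ultimately have "norm (h (Moebius_function 0 p q)) \<le> norm (Moebius_function 0 p q)"
    by (rule Schwarz_Lemma(1))
  then show ?thesis
    using p q by (simp add: h_def Moebius_function_compose)
qed

section \<open>Lower bounds for the squeezing function\<close>

lemma squeezing_ge:
  assumes D: "open D" "p \<in> D"
    and F: "F holomorphic_on D" "inj_on F D" "F ` D \<subseteq> ball 0 1"
    and c: "0 < c" "c \<le> 1"
    and sub: "\<And>\<zeta>. norm \<zeta> < 1 \<Longrightarrow> norm (Moebius_function 0 (F p) \<zeta>) < c \<Longrightarrow> \<zeta> \<in> F ` D"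
  shows "c \<le> squeezing D p"
proof -
  define h where "h = Moebius_function 0 (F p) \<circ> F"
  have Fp: "norm (F p) < 1"
    using F D by auto
  define \<F> where "\<F> = {f. f holomorphic_on D \<and> inj_on f D \<and> f ` D \<subseteq> ball 0 1 \<and> f p = 0}"
  define R where "R f = {r::real. 0 < r \<and> ball 0 r \<subseteq> f ` D}" for f :: "complex \<Rightarrow> complex"
  \<comment> \<open>A real \<open>Sup\<close> is meaningful only for nonempty sets that are bounded
    above. The bound 1 here and \<open>ne\<close> below secure this for both suprema.\<close>
  have le1: "r \<le> 1" if "f \<in> \<F>" "r \<in> R f" for f r
  proof -
    have "ball (0::complex) r \<subseteq> ball 0 1"
      using that unfolding \<F>_def R_def by blast
    then show ?thesis
      using that by (simp add: R_def ball_subset_ball_iff)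
  qed
  have ne: "R f \<noteq> {}" if "f \<in> \<F>" for f
  proof -
    have "open (f ` D)"
      using that D open_mapping_thm3 unfolding \<F>_def by blast
    moreover have "0 \<in> f ` D"
      using that D unfolding \<F>_def by force
    ultimately show ?thesis
      unfolding R_def open_contains_ball by blast
  qed
  have "h \<in> \<F>"
  proof -
    have "h holomorphic_on D"
      unfolding h_def using F(1)
      by (rule holomorphic_on_compose)
         (rule holomorphic_on_subset[OF Moebius_function_holomorphic[OF Fp] F(3)])
    moreover have "inj_on h D"
      unfolding h_def using F(2)
      by (rule comp_inj_on) (rule inj_on_subset[OF inj_on_Moebius[OF Fp] F(3)])
    moreover have "h ` D \<subseteq> ball 0 1"
      using F(3) Fp by (auto simp: h_def intro!: Moebius_function_norm_lt_1)
    ultimately show ?thesis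
      by (simp add: \<F>_def h_def Moebius_function_eq_zero)
  qed
  moreover have "c \<in> R h"
  proof -
    have "y \<in> h ` D" if "norm y < c" for y
    proof -
      have y: "norm y < 1"
        using that c by simp
      define \<zeta> where "\<zeta> = Moebius_function 0 (- F p) y"
      have "norm \<zeta> < 1"
        unfolding \<zeta>_def using Fp y by (simp add: Moebius_function_norm_lt_1)
      moreover have M: "Moebius_function 0 (F p) \<zeta> = y"
        unfolding \<zeta>_def using Fp y by (simp add: Moebius_function_compose)
      ultimately have "\<zeta> \<in> F ` D"
        using sub that by simp
      then show ?thesis
        using M by (auto simp: h_def)
    qed
    then show ?thesis
      using c by (auto simp: R_def)
  qed
  ultimately have "c \<le> Sup (R h)"
    using le1 by (intro cSup_upper bdd_aboveI) auto
  also have "\<dots> \<le> (SUP f\<in>\<F>. Sup (R f))"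
    using \<open>h \<in> \<F>\<close> ne le1 by (intro cSUP_upper bdd_aboveI2[where M = 1] cSup_least) auto
  also have "\<dots> = squeezing D p"
    by (simp add: squeezing_def \<F>_def R_def)
  finally show ?thesis .
qed

section \<open>Connectedness after removing holes\<close>

text \<open>Each side of a separation of the complement of the holes absorbs the discs whose collars
  \<open>W i - K i\<close> it contains, giving a separation of \<open>S\<close>.\<close>

lemma connected_Diff_holes:
  assumes "connected S" and D: "open (S - (\<Union>i\<in>I. K i))"
    and W: "\<And>i. i \<in> I \<Longrightarrow> open (W i)" "\<And>i. i \<in> I \<Longrightarrow> W i \<subseteq> S"
    and K: "\<And>i. i \<in> I \<Longrightarrow> K i \<subseteq> W i"
    and conn: "\<And>i. i \<in> I \<Longrightarrow> connected (W i - K i)" and ne: "\<And>i. i \<in> I \<Longrightarrow> W i - K i \<noteq> {}"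
    and disj: "disjoint_family_on W I"
  shows "connected (S - (\<Union>i\<in>I. K i))"
proof (rule connectedI)
  fix A B
  let ?D = "S - (\<Union>i\<in>I. K i)"
  assume AB: "open A" "open B" "A \<inter> ?D \<noteq> {}" "B \<inter> ?D \<noteq> {}" "A \<inter> B \<inter> ?D = {}" "?D \<subseteq> A \<union> B"
  have WD: "W i - K i \<subseteq> ?D" if "i \<in> I" for i
  proof
    fix x assume x: "x \<in> W i - K i"
    have "x \<notin> K j" if "j \<in> I" for j
      using x K[OF that] disjoint_family_onD[OF disj \<open>i \<in> I\<close> that] by blast
    then show "x \<in> ?D"
      using x W(2)[OF \<open>i \<in> I\<close>] by blast
  qed
  define fill where "fill C = (C \<inter> ?D) \<union> (\<Union>i\<in>{i\<in>I. W i - K i \<subseteq> C}. W i)" for C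
  have side: "W i - K i \<subseteq> A \<or> W i - K i \<subseteq> B" if "i \<in> I" for i
  proof -
    have "A \<inter> B \<inter> (W i - K i) = {}"
      using WD[OF that] AB(5) by auto
    moreover have "W i - K i \<subseteq> A \<union> B"
      using WD[OF that] AB(6) by (rule subset_trans)
    ultimately have "A \<inter> (W i - K i) = {} \<or> B \<inter> (W i - K i) = {}"
      using connectedD[OF conn[OF that] AB(1,2)] by blast
    then show ?thesis
      using \<open>W i - K i \<subseteq> A \<union> B\<close> by blast
  qed
  have "open (fill C)" if "open C" for C
    unfolding fill_def using that D W(1) by (intro open_Un open_Int open_UN) auto
  then have "open (fill A)" "open (fill B)"
    using AB by auto
  moreover have "S \<subseteq> fill A \<union> fill B"
  proof
    fix x assume "x \<in> S"
    show "x \<in> fill A \<union> fill B"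
    proof (cases "x \<in> ?D")
      case True
      then show ?thesis
        using AB(6) unfolding fill_def by auto
    next
      case False
      then obtain i where "i \<in> I" "x \<in> W i"
        using \<open>x \<in> S\<close> K by blast
      then show ?thesis
        using side[of i] unfolding fill_def by auto
    qed
  qed
  moreover have "x \<notin> fill B" if xA: "x \<in> fill A" for x
  proof
    assume xB: "x \<in> fill B"
    show False
    proof (cases "x \<in> ?D")
      case True
      then have "x \<in> A" "x \<in> B"
        using xA xB unfolding fill_def by auto
      then show False
        using True AB(5) by blast
    next
      case False
      \<comment> \<open>Outside \<open>?D\<close> a point enters \<open>fill C\<close> only through
        an absorbed disc. Disjointness then makes the discs for \<open>A\<close> and
        \<open>B\<close> the same one, whose nonempty collar would lie on both sides.\<close>
      have "\<exists>i\<in>I. x \<in> W i \<and> W i - K i \<subseteq> C" if "x \<in> fill C" for C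
        using that False unfolding fill_def by auto
      then obtain i j where ij: "i \<in> I" "j \<in> I" "x \<in> W i" "x \<in> W j"
          "W i - K i \<subseteq> A" "W j - K j \<subseteq> B"
        using xA xB by meson
      then have "i = j"
        using disjoint_family_onD[OF disj, of i j] by blast
      then have "W i - K i \<subseteq> A \<inter> B \<inter> ?D"
        using ij WD[OF ij(1)] by auto
      then show False
        using ne[OF ij(1)] AB(5) by simp
    qed
  qed
  moreover have "A \<inter> ?D \<subseteq> fill A" "B \<inter> ?D \<subseteq> fill B"
    unfolding fill_def by auto
  ultimately have "fill A \<inter> fill B \<inter> S = {}" "A \<inter> ?D \<subseteq> fill A \<inter> S" "B \<inter> ?D \<subseteq> fill B \<inter> S"
    by auto
  then show False
    using connectedD[OF \<open>connected S\<close> \<open>open (fill A)\<close> \<open>open (fill B)\<close>] \<open>S \<subseteq> fill A \<union> fill B\<close> AB(3,4)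
    by (metis subset_empty)
qed

theorem theorem5p9:
  fixes u v w :: real and r :: "nat \<Rightarrow> real" and f :: "nat \<Rightarrow> complex \<Rightarrow> complex"
  assumes "0 < u" and "u < v" and "v < w" and "w < 1"
    and "\<And>k. k \<ge> 1 \<Longrightarrow> u < r k \<and> r k < v"
    and "\<And>k. k \<ge> 1 \<Longrightarrow> f k \<in> holomorphic_aut (ball 0 1)"
    and "disjoint_family_on (\<lambda>k. f k ` cball 0 w) {1..}"
  shows "holomorphic_homogeneous_regular (ball 0 1 - (\<Union>k\<in>{1..}. f k ` cball 0 (r k)))"
proof -
  note uvw = assms(1-4) and r = assms(5)
  define D where "D = ball 0 1 - (\<Union>k\<in>{1..}. f k ` cball 0 (r k))"
  define m where "m = (v + w) / 2"
  have m: "v < m" "m < w" "0 < m"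
    using uvw by (auto simp: m_def)
  \<comment> \<open>The second entry serves points far from all holes, the third the inversion near
    a hole, where \<open>u\<close> bounds every \<open>r k\<close> from below. Both halves absorb
    the factor 2 of \<open>norm_diff_le_Moebius\<close>.\<close>
  define c where "c = Min {1, (m - v) / 2, u * (1 / m - 1 / w) / 2}"
  have "1 / w < 1 / m"
    using m uvw by (simp add: divide_simps)
  then have "0 < c"
    using m uvw by (simp add: c_def)
  moreover have "c \<le> 1" "c \<le> (m - v) / 2" "c \<le> u * (1 / m - 1 / w) / 2"
    unfolding c_def by (intro Min_le; simp)+
  ultimately have c: "0 < c" "c \<le> 1" "2 * c \<le> m - v" "2 * c \<le> u * (1 / m - 1 / w)"
    by (simp_all only: le_divide_eq_numeral1 mult.commute[of c])

  have "\<forall>k\<in>{1..}. \<exists>h. h holomorphic_on ball 0 1 \<and> h ` ball 0 1 \<subseteq> ball 0 1 \<and>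
      (\<forall>z\<in>ball 0 1. h (f k z) = z \<and> f k (h z) = z)"
    using assms(6) unfolding holomorphic_aut_def by auto
  then obtain g where "\<forall>k\<in>{1..}. g k holomorphic_on ball 0 1 \<and> g k ` ball 0 1 \<subseteq> ball 0 1 \<and>
      (\<forall>z\<in>ball 0 1. g k (f k z) = z \<and> f k (g k z) = z)"
    by metis
  then have g: "g k holomorphic_on ball 0 1" "g k ` ball 0 1 \<subseteq> ball 0 1"
    and gf: "\<And>z. norm z < 1 \<Longrightarrow> g k (f k z) = z" and fg: "\<And>z. norm z < 1 \<Longrightarrow> f k (g k z) = z"
    if "k \<ge> 1" for k using that by auto
  have f: "f k holomorphic_on ball 0 1" "f k ` ball 0 1 \<subseteq> ball 0 1" if "k \<ge> 1" for k
    using assms(6)[OF that] unfolding holomorphic_aut_def by auto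
  have f1: "norm (f k z) < 1" if "k \<ge> 1" "norm z < 1" for k z
    using f(2)[OF that(1)] that(2) by (meson image_subset_iff mem_ball_0)
  have g1: "norm (g k z) < 1" if "k \<ge> 1" "norm z < 1" for k z
    using g(2)[OF that(1)] that(2) by (meson image_subset_iff mem_ball_0)
  have injf: "inj_on (f k) (ball 0 1)" if "k \<ge> 1" for k
    by (rule inj_on_inverseI[where g = "g k"]) (use gf that in auto)
  have injg: "inj_on (g k) (ball 0 1)" if "k \<ge> 1" for k
    by (rule inj_on_inverseI[where g = "f k"]) (use fg that in auto)
  have disj: "i = j" if "i \<ge> 1" "j \<ge> 1" "norm a \<le> w" "norm b \<le> w" "f i a = f j b" for i j a b
    using assms(7) that unfolding disjoint_family_on_def
    by (metis IntI atLeast_iff empty_iff imageI mem_cball_0)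

  \<comment> \<open>Points of \<open>D\<close> in the coordinates \<open>g k\<close>\<close>
  have in_D: "q \<in> D" if "norm q < 1" "\<And>k. k \<ge> 1 \<Longrightarrow> r k < norm (g k q)" for q
  proof -
    have "q \<noteq> f k a" if k: "k \<in> {1..}" and a: "a \<in> cball 0 (r k)" for k a
      using gf[of k a] \<open>\<And>k. k \<ge> 1 \<Longrightarrow> r k < norm (g k q)\<close>[of k] r[of k] k a uvw by auto
    moreover have "q \<in> ball 0 1"
      using that(1) by simp
    ultimately show ?thesis
      unfolding D_def by blast
  qed
  have D_1: "norm q < 1" if "q \<in> D" for q
    using that by (auto simp: D_def)
  have D_r: "r k < norm (g k q)" if "q \<in> D" "k \<ge> 1" for k q
  proof (rule ccontr)
    assume "\<not> ?thesis"
    then have "f k (g k q) \<in> f k ` cball 0 (r k)"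
      by auto
    then show False
      using that fg[OF that(2) D_1[OF that(1)]] by (auto simp: D_def)
  qed
  \<comment> \<open>A collar point lying in hole \<open>j\<close> would belong to both
    \<open>f j\<close> cball 0 w\<open>and\<close>f k \<open>cball 0 w\<close>. So
    \<open>j = k\<close>, and injectivity contradicts \<open>r k < norm a\<close>.\<close>
  have ann_D: "f k a \<in> D" if k: "k \<ge> 1" and a: "r k < norm a" "norm a < w" for k a
  proof (rule in_D)
    show fa: "norm (f k a) < 1"
      using f1 k a uvw by simp
    fix j :: nat assume j: "j \<ge> 1"
    show "r j < norm (g j (f k a))"
    proof (rule ccontr)
      assume "\<not> ?thesis"
      then have n: "norm (g j (f k a)) \<le> r j" by simp
      have "f j (g j (f k a)) = f k a"
        using fg j fa by simp
      then have "j = k"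
        using disj[OF j k, of "g j (f k a)" a] n r[OF j] uvw a by auto
      then show False
        using n a gf[OF k, of a] uvw by simp
    qed
  qed
  \<comment> \<open>By Schwarz-Pick, passing from \<open>p\<close> to \<open>q\<close> moves every
    \<open>g k\<close> by less than \<open>2 * c\<close>, uniformly in \<open>k\<close>. The norm
    therefore stays above \<open>m - (m - v) = v\<close>.\<close>
  have far_D: "q \<in> D" if p: "norm p < 1" "\<And>k. k \<ge> 1 \<Longrightarrow> m \<le> norm (g k p)"
    and q: "norm q < 1" "norm (Moebius_function 0 p q) < c" for p q
  proof (rule in_D[OF q(1)])
    fix k :: nat assume k: "k \<ge> 1"
    have "norm (g k q - g k p) \<le> 2 * norm (Moebius_function 0 (g k p) (g k q))"
      using norm_diff_le_Moebius g1 k p(1) q(1) by simp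
    also have "\<dots> \<le> 2 * norm (Moebius_function 0 p q)"
      using Schwarz_Pick[OF g[OF k] p(1) q(1)] by simp
    also have "\<dots> < m - v"
      using q(2) c by simp
    finally have "norm (g k p - g k q) < m - v"
      by (simp add: norm_minus_commute)
    then show "r k < norm (g k q)"
      using p(2)[OF k] r[OF k] norm_triangle_ineq2[of "g k p" "g k q"] by simp
  qed

  \<comment> \<open>Openness and connectedness of \<open>D\<close>\<close>
  have "open D"
    \<comment> \<open>An infinite union of closed holes need not be closed, so neighbourhoods are
      built by hand: the open collar near a hole, a pseudohyperbolic disc of radius \<open>c\<close>
      elsewhere.\<close>
    unfolding open_subopen[of D]
  proof
    fix p assume p: "p \<in> D"
    show "\<exists>T. open T \<and> p \<in> T \<and> T \<subseteq> D"
    proof (cases "\<exists>k\<ge>1. norm (g k p) < m")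
      case True
      then obtain k where k: "k \<ge> 1" "norm (g k p) < m" by blast
      let ?A = "{a::complex. r k < norm a \<and> norm a < w}"
      have "open ?A"
        by (intro open_Collect_conj open_Collect_less continuous_intros)
      moreover have "?A \<subseteq> ball 0 1"
        using uvw by auto
      ultimately have "open (f k ` ?A)"
        using f(1) injf k(1) by (meson holomorphic_on_subset inj_on_subset open_mapping_thm3)
      moreover have "p \<in> f k ` ?A"
        using fg[OF k(1) D_1[OF p]] D_r[OF p k(1)] k m by (intro image_eqI[where x = "g k p"]) auto
      ultimately show ?thesis
        using ann_D k(1) by (intro exI[of _ "f k ` ?A"]) auto
    next
      case False
      let ?T = "ball 0 1 \<inter> Moebius_function 0 p -` ball 0 c"
      have "open ?T"
        using Moebius_function_holomorphic[of p 0] D_1[OF p]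
        by (intro continuous_open_preimage) (auto intro: holomorphic_on_imp_continuous_on)
      moreover have "p \<in> ?T"
        using D_1[OF p] c by (simp add: Moebius_function_eq_zero)
      moreover have "?T \<subseteq> D"
        using far_D[of p] False D_1[OF p] by (auto simp: not_less)
      ultimately show ?thesis by blast
    qed
  qed

  have "connected D"
    unfolding D_def
  proof (rule connected_Diff_holes[where W = "\<lambda>k. f k ` ball 0 w"])
    show "open (ball 0 1 - (\<Union>k\<in>{1..}. f k ` cball 0 (r k)))"
      using \<open>open D\<close> by (simp add: D_def)
    show "disjoint_family_on (\<lambda>k. f k ` ball 0 w) {1..}"
      using assms(7) unfolding disjoint_family_on_def by (meson ball_subset_cball disjoint_iff image_mono subsetD)
    fix k :: nat assume "k \<in> {1..}"
    then have k: "k \<ge> 1" by simp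
    have ww: "ball (0::complex) w \<subseteq> ball 0 1"
      using uvw by auto
    show "open (f k ` ball 0 w)"
      using f(1)[OF k] injf[OF k] ww
      by (meson holomorphic_on_subset inj_on_subset open_ball open_mapping_thm3)
    show "f k ` ball 0 w \<subseteq> ball 0 1"
      using f(2)[OF k] ww by blast
    show "f k ` cball 0 (r k) \<subseteq> f k ` ball 0 w"
      using r[OF k] uvw by auto
    \<comment> \<open>The form \<open>a - 0\<close> matches
      \<open>connected_annulus\<close>.\<close>
    let ?A = "{a::complex. r k < norm (a - 0) \<and> norm (a - 0) < w}"
    have "f k ` ball 0 w - f k ` cball 0 (r k) = f k ` (ball 0 w - cball 0 (r k))"
      by (rule inj_on_image_set_diff[OF injf[OF k], symmetric]) (use ww r[OF k] uvw in auto)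
    also have "ball 0 w - cball 0 (r k) = ?A"
      by auto
    finally have eq: "f k ` ball 0 w - f k ` cball 0 (r k) = f k ` ?A" .
    have "continuous_on ?A (f k)"
      by (rule continuous_on_subset[OF holomorphic_on_imp_continuous_on[OF f(1)[OF k]]])
         (use uvw in auto)
    then show "connected (f k ` ball 0 w - f k ` cball 0 (r k))"
      unfolding eq using connected_annulus[of "r k" "0::complex" w]
      by (intro connected_continuous_image) auto
    have "of_real m \<in> ?A"
      using m r[OF k] by simp
    then show "f k ` ball 0 w - f k ` cball 0 (r k) \<noteq> {}"
      unfolding eq by blast
  qed simp

  have "D \<noteq> {}"
    using ann_D[of 1 "of_real m"] m r[of 1] by auto
  moreover have "bounded D"
    unfolding D_def by (rule bounded_subset[OF bounded_ball]) auto

  \<comment> \<open>The uniform lower bound for the squeezing function\<close>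
  moreover have "c \<le> squeezing D p" if p: "p \<in> D" for p
  proof (cases "\<exists>k\<ge>1. norm (g k p) < m")
    case True
    then obtain k where k: "k \<ge> 1" "norm (g k p) < m" by blast
    define F where "F z = of_real (r k) / g k z" for z
    have rk: "0 < r k" "u < r k" "r k < v"
      using r[OF k(1)] uvw by auto
    have gD: "g k z \<noteq> 0" if "z \<in> D" for z
      using D_r[OF that k(1)] rk by auto
    have DB: "D \<subseteq> ball 0 1"
      using D_1 by auto
    show ?thesis
    proof (rule squeezing_ge[OF \<open>open D\<close> p _ _ _ c(1,2)])
      show "F holomorphic_on D"
        unfolding F_def using gD holomorphic_on_subset[OF g(1)[OF k(1)] DB]
        by (intro holomorphic_intros) auto
      show "inj_on F D"
        using inj_on_subset[OF injg[OF k(1)] DB] gD rk unfolding F_def inj_on_def by simp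
      show "F ` D \<subseteq> ball 0 1"
        using D_r[OF _ k(1)] gD rk by (auto simp: F_def norm_divide divide_simps)
      fix \<zeta> :: complex
      assume \<zeta>: "norm \<zeta> < 1" "norm (Moebius_function 0 (F p) \<zeta>) < c"
      have gp: "0 < norm (g k p)"
        using gD[OF p] by simp
      have Fp: "norm (F p) < 1"
        using D_r[OF p k(1)] gp by (simp add: F_def norm_divide rk less_imp_le)
      have "norm (F p) = r k / norm (g k p)"
        using rk by (simp add: F_def norm_divide)
      also have "\<dots> > r k / m"
        using k(2) gp rk m(3) by (intro divide_strict_left_mono) auto
      finally have Fm: "r k / m < norm (F p)" .
      have "norm (F p) - norm \<zeta> \<le> norm (\<zeta> - F p)"
        by (metis norm_minus_commute norm_triangle_ineq2)
      also have "\<dots> < 2 * c"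
        using norm_diff_le_Moebius[OF Fp \<zeta>(1)] \<zeta>(2) by simp
      also have "\<dots> \<le> r k * (1 / m - 1 / w)"
        by (rule order_trans[OF c(4) mult_right_mono]) (use rk \<open>1 / w < 1 / m\<close> in auto)
      finally have big: "r k / w < norm \<zeta>"
        using Fm by (simp add: algebra_simps)
      then have "0 < norm \<zeta>"
        using rk uvw by (smt (verit) divide_pos_pos)
      \<comment> \<open>This solves \<open>r k / a = \<zeta>\<close>. The bounds
        \<open>r k / w < norm \<zeta> < 1\<close> become \<open>r k < norm a < w\<close>, so
        \<open>f k a\<close> is a collar point and hence in \<open>D\<close>.\<close>
      define a where "a = of_real (r k) / \<zeta>"
      have a: "r k < norm a" "norm a < w"
        using \<open>0 < norm \<zeta>\<close> \<zeta>(1) big rk uvw by (auto simp: a_def norm_divide field_simps)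
      then have "F (f k a) = \<zeta>"
        using gf[OF k(1), of a] rk uvw by (simp add: F_def) (simp add: a_def)
      then show "\<zeta> \<in> F ` D"
        using ann_D[OF k(1) a] by blast
    qed
  next
    case False
    show ?thesis
    \<comment> \<open>The inclusion of \<open>D\<close> suffices here, since
      \<open>squeezing_ge\<close> supplies the Moebius map centring \<open>p\<close>.\<close>
    proof (rule squeezing_ge[OF \<open>open D\<close> p, where F = "\<lambda>z. z"])
      fix q assume "norm q < 1" "norm (Moebius_function 0 p q) < c"
      then show "q \<in> (\<lambda>z. z) ` D"
        using far_D[of p q] False D_1[OF p] by (auto simp: not_less)
    qed (use c D_1 in auto)
  qed
  ultimately show ?thesis
    using \<open>open D\<close> \<open>connected D\<close> c(1)
    unfolding holomorphic_homogeneous_regular_def bounded_domain_def D_def by blast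
qed

end
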